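(* Let $n,m$ be integers with $0\le m\le n$, and let $$i_{\max}(n,m)=\Big\lfloor \tfrac12\big(\sqrt{8n+(2m-1)^2}-2m-1\big)\Big\rfloor .$$ Then $$P(n,m)=P(n-m)+\sum_{i=1}^{i_{\max}(n,m)}(-1)^i\sum_{k=\frac12 i(i+1)}^{n-m(i+1)}P\big(k-\tfrac12 i(i-1),\,i\big)\,P\big(n-k-m(i+1)\big),$$ where an empty sum is $0$.
   Context: $P(n)$ denotes the number of integer partitions of $n$ (with $P(0)=1$), and $P(n,m)$ denotes the number of integer partitions of $n$ into exactly $m$ (positive) parts, with $P(0,0)=1$, $P(n,0)=0$ for $n>0$, and $P(n,m)=0$ for $n<m$. *)

theory Defs
  imports Complex_Main "HOL-Library.Multiset"
begin

definition partitions :: "nat \<Rightarrow> nat multiset set" where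
  "partitions n = {M. (\<forall>x \<in># M. 0 < x) \<and> sum_mset M = n}"

definition num_partitions :: "nat \<Rightarrow> nat" where
  "num_partitions n = card (partitions n)"

definition num_partitions_parts :: "nat \<Rightarrow> nat \<Rightarrow> nat" where
  "num_partitions_parts n m = card {M \<in> partitions n. size M = m}"

definition i_max :: "nat \<Rightarrow> nat \<Rightarrow> int" where
  "i_max n m = \<lfloor>(sqrt (8 * real n + (2 * real m - 1)\<^sup>2) - 2 * real m - 1) / 2\<rfloor>"

text \<open>For \<open>m \<le> n\<close>, \<open>i_max n m\<close> is the largest natural number \<open>i\<close> with
  \<open>i * (i + 1) div 2 + m * (i + 1) \<le> n\<close>.  Hence it is nonnegative, and in a
  sum over \<open>1 \<le> i \<le> i_max n m\<close> the natural-number differences \<open>n - m * (i + 1)\<close> and,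
  for \<open>i * (i + 1) div 2 \<le> k \<le> n - m * (i + 1)\<close>, \<open>k - i * (i - 1) div 2\<close> and
  \<open>n - k - m * (i + 1)\<close> are not truncated.\<close>

text \<open>The sets above are finite, so \<^const>\<open>card\<close> really counts, and the usual
  boundary conventions hold.\<close>

lemma size_le_sum_mset: "(\<forall>x \<in># M. 0 < x) \<Longrightarrow> size M \<le> sum_mset M" for M :: "nat multiset"
  by (induction M) auto

lemma size_le_partitions:
  assumes "M \<in> partitions n"
  shows "size M \<le> n"
proof -
  have "\<forall>x \<in># M. 0 < x" and "sum_mset M = n"
    using assms unfolding partitions_def by blast+
  with size_le_sum_mset show ?thesis by blast
qed

lemma finite_partitions: "finite (partitions n)"
proof -
  have "partitions n \<subseteq> mset ` {xs. set xs \<subseteq> {..n} \<and> length xs \<le> n}"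
  proof
    fix M assume M: "M \<in> partitions n"
    obtain xs where xs: "M = mset xs" by (metis ex_mset)
    have "x \<le> n" if "x \<in># M" for x
      using M sum_mset.remove[OF that] by (auto simp: partitions_def)
    moreover have "size M \<le> n" using M by (rule size_le_partitions)
    ultimately show "M \<in> mset ` {xs. set xs \<subseteq> {..n} \<and> length xs \<le> n}"
      using xs by auto
  qed
  then show ?thesis by (rule finite_subset) (simp add: finite_lists_length_le)
qed

lemma partitions_0: "partitions 0 = {{#}}"
proof (intro equalityI subsetI)
  fix M assume "M \<in> partitions 0"
  then have "size M \<le> 0" by (rule size_le_partitions)
  then show "M \<in> {{#}}" by simp
qed (simp add: partitions_def)

lemma num_partitions_0: "num_partitions 0 = 1"
  by (simp add: num_partitions_def partitions_0)

lemma num_partitions_parts_0_0: "num_partitions_parts 0 0 = 1"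
proof -
  have "{M \<in> partitions 0. size M = 0} = {{#}}" by (auto simp: partitions_0)
  then show ?thesis by (simp add: num_partitions_parts_def)
qed

lemma num_partitions_parts_n_0: "0 < n \<Longrightarrow> num_partitions_parts n 0 = 0"
  by (auto simp: num_partitions_parts_def partitions_def)

lemma num_partitions_parts_eq_0:
  assumes "n < m"
  shows "num_partitions_parts n m = 0"
proof -
  have "{M \<in> partitions n. size M = m} = {}"
    using assms size_le_partitions by (blast dest: leD)
  then show ?thesis by (simp only: num_partitions_parts_def card.empty)
qed

end

theory Submission
  imports Defs
begin

text \<open>By conjugation, \<open>P(n, m)\<close> counts the partitions of \<open>n - m\<close> into parts of size at most
  \<open>m\<close>.  Inclusion-exclusion over the sets \<open>S\<close> of forbidden parts (those exceeding \<open>m\<close>) gives the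
  signed sum of \<open>P(n - m - \<Sum>S)\<close>.  An \<open>i\<close>-element set \<open>S\<close> of numbers exceeding \<open>m\<close> becomes a
  partition into exactly \<open>i\<close> parts on subtracting \<open>m\<close> from every element and then
  \<open>0, 1, \<dots>, i - 1\<close> from the elements in increasing order, so collecting the sets \<open>S\<close> according to
  \<open>i = card S\<close> and \<open>k = \<Sum>S - m * i\<close> yields the formula.  The two bijections are replaced by
  the observation that both sides satisfy the recurrence
  \<open>P(n + m + 1, m + 1) = P(n, m + 1) + P(n + m, m)\<close>.\<close>

section \<open>Recurrence for partitions by number of parts\<close>

lemma sum_mset_image_Suc: "sum_mset (image_mset Suc M) = sum_mset M + size M"
  by (induction M) auto

lemma inj_on_add_mset: "inj_on (add_mset x) X"
  by (auto simp: inj_on_def)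

lemma mset_set_subseteq:
  assumes "S \<subseteq> set_mset M"
  shows "mset_set S \<subseteq># M"
proof -
  have "mset_set S \<subseteq># mset_set (set_mset M)"
    using assms by (simp add: subset_imp_msubset_mset_set)
  then show ?thesis
    using mset_set_set_mset_msubset by (rule subset_mset.order_trans)
qed

text \<open>Split according to whether 1 is a part. If it is, delete one copy; if not, every part
  exceeds 1, and lowering all \<open>Suc m\<close> parts by one keeps them positive.\<close>

lemma num_partitions_parts_recurrence:
  "num_partitions_parts (n + Suc m) (Suc m) =
    num_partitions_parts n (Suc m) + num_partitions_parts (n + m) m"
proof -
  let ?P = "\<lambda>n m. {M \<in> partitions n. size M = m}"
  have "?P (n + Suc m) (Suc m) =
      image_mset Suc ` ?P n (Suc m) \<union> add_mset 1 ` ?P (n + m) m" (is "?L = ?A \<union> ?B")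
  proof (intro equalityI subsetI)
    fix M assume M: "M \<in> ?L"
    show "M \<in> ?A \<union> ?B"
    proof (cases "1 \<in># M")
      case True
      then obtain M' where M': "M = add_mset 1 M'" by (metis mset_add)
      with M have "M' \<in> ?P (n + m) m" by (auto simp: partitions_def)
      with M' show ?thesis by blast
    next
      case False
      let ?M' = "image_mset (\<lambda>x. x - 1) M"
      have gt: "1 < x" if "x \<in># M" for x
        using that False M by (cases "x = 1") (auto simp: partitions_def intro: Suc_lessI)
      then have "image_mset Suc ?M' = image_mset id M"
        unfolding multiset.map_comp by (intro image_mset_cong) force
      then have M': "M = image_mset Suc ?M'" by simp
      then have "sum_mset M = sum_mset ?M' + size M"
        using sum_mset_image_Suc[of ?M'] by simp
      with M gt have "?M' \<in> ?P n (Suc m)" by (auto simp: partitions_def)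
      with M' show ?thesis by blast
    qed
  next
    fix M assume "M \<in> ?A \<union> ?B"
    then show "M \<in> ?L"
      by (auto simp: partitions_def sum_mset_image_Suc)
  qed
  moreover have "?A \<inter> ?B = {}"
  proof -
    have "image_mset Suc M \<noteq> add_mset 1 M'" if "M \<in> partitions n" for M M'
    proof
      assume "image_mset Suc M = add_mset 1 M'"
      then have "1 \<in># image_mset Suc M" by simp
      with that show False by (auto simp: partitions_def)
    qed
    then show ?thesis by blast
  qed
  moreover have "inj_on (image_mset Suc) X" for X
    using multiset.inj_map[OF inj_Suc] by (rule inj_on_subset) simp
  moreover have "finite (?P a b)" for a b
    using finite_partitions by simp
  ultimately show ?thesis
    unfolding num_partitions_parts_def by (simp add: card_Un_disjoint card_image inj_on_add_mset)
qed

section \<open>Partitions with bounded or prescribed parts\<close>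

lemma card_partitions_bounded_rec:
  "card {M \<in> partitions n. \<forall>x\<in>#M. x \<le> Suc m} =
    card {M \<in> partitions n. \<forall>x\<in>#M. x \<le> m} +
    (if Suc m \<le> n then card {M \<in> partitions (n - Suc m). \<forall>x\<in>#M. x \<le> Suc m} else 0)"
proof -
  let ?B = "\<lambda>n m. {M \<in> partitions n. \<forall>x\<in>#M. x \<le> m}"
  \<comment> \<open>The partitions in which \<open>Suc m\<close> occurs, with one copy split off.
    There are none for \<open>n < Suc m\<close>, where the truncated difference 0 would wrongly
    admit the empty partition.\<close>
  let ?C = "if Suc m \<le> n then add_mset (Suc m) ` ?B (n - Suc m) (Suc m) else {}"
  have "?B n (Suc m) = ?B n m \<union> ?C"
  proof (intro equalityI subsetI)
    fix M assume M: "M \<in> ?B n (Suc m)"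
    show "M \<in> ?B n m \<union> ?C"
    proof (cases "Suc m \<in># M")
      case True
      then obtain M' where M': "M = add_mset (Suc m) M'" by (metis mset_add)
      with M have "M' \<in> ?B (n - Suc m) (Suc m)" "Suc m \<le> n" by (auto simp: partitions_def)
      with M' show ?thesis by auto
    next
      case False
      with M show ?thesis by (auto simp: le_Suc_eq)
    qed
  qed (auto simp: partitions_def split: if_splits)
  moreover have "?B n m \<inter> ?C = {}" by (auto split: if_splits)
  moreover have "finite (?B a b)" for a b
    using finite_partitions by simp
  ultimately show ?thesis
    by (simp add: card_Un_disjoint card_image inj_on_add_mset)
qed

text \<open>This is conjugation, obtained by induction on \<open>n + m\<close>: removing a copy of
  the largest admissible part on the left mirrors the recurrence for the number of parts on the
  right.\<close>

lemma card_partitions_bounded: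
  "card {M \<in> partitions n. \<forall>x\<in>#M. x \<le> m} = num_partitions_parts (n + m) m"
proof (induction "n + m" arbitrary: n m rule: less_induct)
  case less
  show ?case
  proof (cases m)
    case 0
    have "{M \<in> partitions n. \<forall>x\<in>#M. x \<le> 0} = {M \<in> partitions n. size M = 0}"
      by (auto simp: partitions_def) (metis multiset_nonemptyE less_irrefl)
    with 0 show ?thesis by (simp add: num_partitions_parts_def)
  next
    case (Suc l)
    have "(if Suc l \<le> n then card {M \<in> partitions (n - Suc l). \<forall>x\<in>#M. x \<le> Suc l} else 0) =
        num_partitions_parts n (Suc l)"
      using less[of "n - Suc l" "Suc l"] Suc by (simp add: num_partitions_parts_eq_0)
    moreover have "card {M \<in> partitions n. \<forall>x\<in>#M. x \<le> l} = num_partitions_parts (n + l) l"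
      using less[of n l] Suc by simp
    ultimately show ?thesis
      unfolding Suc card_partitions_bounded_rec[of n l] num_partitions_parts_recurrence by linarith
  qed
qed

text \<open>Deleting one copy of each element of \<open>S\<close> is reversible: adding
  \<open>mset_set S\<close> to any partition of the remainder gives positive parts again because
  \<open>0 \<notin> S\<close>.\<close>

lemma card_partitions_superset:
  assumes "finite S" "0 \<notin> S" "\<Sum>S \<le> n"
  shows "card {M \<in> partitions n. S \<subseteq> set_mset M} = num_partitions (n - \<Sum>S)"
proof -
  have S: "sum_mset (mset_set S) = \<Sum>S"
    by (simp add: sum_unfold_sum_mset)
  have "{M \<in> partitions n. S \<subseteq> set_mset M} = (+) (mset_set S) ` partitions (n - \<Sum>S)" (is "?L = ?R")
  proof (intro equalityI subsetI)
    fix M assume M: "M \<in> ?L"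
    then have "mset_set S \<subseteq># M"
      by (simp add: mset_set_subseteq)
    then obtain M' where "M = mset_set S + M'" by (metis subset_mset.add_diff_inverse)
    with M show "M \<in> ?R" by (auto simp: partitions_def S)
  next
    fix M assume "M \<in> ?R"
    with assms show "M \<in> ?L" by (auto simp: partitions_def S intro!: gr0I)
  qed
  then show ?thesis
    by (simp add: num_partitions_def card_image)
qed

section \<open>Sets of distinct parts\<close>

lemma sum_lower_bound:
  fixes S :: "nat set"
  assumes "finite S" "S \<subseteq> {m<..}"
  shows "card S * (card S + 1) div 2 + m * card S \<le> \<Sum>S"
  using assms
proof (induction S rule: finite_linorder_max_induct)
  case (insert b A)
  \<comment> \<open>Elements arrive in increasing order, so \<open>A\<close> fits strictly between
    \<open>m\<close> and the new maximum \<open>b\<close>, which forces \<open>b\<close> to be at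
    least \<open>m + card A + 1\<close>.\<close>
  have "A \<subseteq> {m<..<b}" using insert by auto
  then have "card A \<le> b - Suc m" using card_mono[of "{m<..<b}" A] by simp
  with insert have "Suc (card A) + m \<le> b" by auto
  moreover have "b \<notin> A" using insert by auto
  ultimately show ?case using insert by auto
qed simp

text \<open>Distinctness is encoded by using sets, the form in which forbidden parts enter the
  inclusion-exclusion.\<close>

definition distinct_partitions :: "nat \<Rightarrow> nat \<Rightarrow> nat set set" where
  "distinct_partitions i s = {S. finite S \<and> 0 \<notin> S \<and> card S = i \<and> \<Sum>S = s}"

lemma finite_distinct_partitions: "finite (distinct_partitions i s)"
proof (rule finite_subset)
  show "distinct_partitions i s \<subseteq> Pow {..s}"
    by (auto simp: distinct_partitions_def intro: member_le_sum[where f = "\<lambda>x. x"])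
qed simp

lemma sum_image_add: "\<Sum>((+) m ` S) = \<Sum>S + m * card S" for S :: "nat set"
  by (simp add: sum.reindex sum.distrib)

text \<open>Lower every element by one, which takes \<open>Suc i\<close> off the sum. An element 1
  would become 0 and is dropped, leaving only \<open>i\<close> elements.\<close>

lemma card_distinct_partitions_rec:
  "card (distinct_partitions (Suc i) (s + Suc i)) =
    card (distinct_partitions (Suc i) s) + card (distinct_partitions i s)"
proof -
  let ?f = "\<lambda>S. Suc ` S" and ?g = "\<lambda>S. insert 1 (Suc ` S)"
  let ?A = "?f ` distinct_partitions (Suc i) s" and ?B = "?g ` distinct_partitions i s"
  have sum: "\<Sum>(Suc ` S) = \<Sum>S + card S" for S
    using sum_image_add[of 1 S] by simp
  have "distinct_partitions (Suc i) (s + Suc i) = ?A \<union> ?B"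
  proof (intro equalityI subsetI)
    fix S assume S: "S \<in> distinct_partitions (Suc i) (s + Suc i)"
    define T where "T = {x. x > 0 \<and> Suc x \<in> S}"
    have fin: "finite T"
      by (rule finite_subset[of _ "(\<lambda>x. x - 1) ` S"])
        (use S in \<open>force simp: T_def distinct_partitions_def\<close>)+
    have T0: "0 \<notin> T" "Suc 0 \<notin> Suc ` T" by (auto simp: T_def)
    have T: "Suc ` T = S - {1}"
    proof (intro equalityI subsetI)
      fix x assume x: "x \<in> S - {1}"
      then have "x > 1" using S by (cases "x = 0") (auto simp: distinct_partitions_def)
      with x show "x \<in> Suc ` T" by (intro image_eqI[of _ _ "x - 1"]) (auto simp: T_def)
    qed (auto simp: T_def)
    show "S \<in> ?A \<union> ?B"
    proof (cases "1 \<in> S")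
      case True
      then have S': "S = insert 1 (Suc ` T)" using T by auto
      then have "T \<in> distinct_partitions i s"
        using S fin T0 unfolding S'
        by (auto simp: distinct_partitions_def sum card_insert_if card_image)
      with S' show ?thesis by blast
    next
      case False
      then have S': "S = Suc ` T" using T by auto
      then have "T \<in> distinct_partitions (Suc i) s"
        using S fin T0 unfolding S' by (auto simp: distinct_partitions_def sum card_image)
      with S' show ?thesis by blast
    qed
  next
    fix S assume "S \<in> ?A \<union> ?B"
    then show "S \<in> distinct_partitions (Suc i) (s + Suc i)"
      by (auto simp: distinct_partitions_def sum card_image card_insert_if inj_image_mem_iff)
  qed
  moreover have "?A \<inter> ?B = {}" by (auto simp: distinct_partitions_def)
  moreover have "inj_on ?f X" for X by (auto simp: inj_on_def)
  moreover have "inj_on ?g (distinct_partitions i s)"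
  proof (rule inj_onI)
    fix S T assume ST: "S \<in> distinct_partitions i s" "T \<in> distinct_partitions i s"
      and eq: "?g S = ?g T"
    have "1 \<notin> Suc ` S" "1 \<notin> Suc ` T" using ST by (auto simp: distinct_partitions_def)
    then have "Suc ` S = Suc ` T" using eq insert_ident by metis
    then show "S = T" by (simp only: inj_image_eq_iff[OF inj_Suc])
  qed
  ultimately show ?thesis
    by (simp add: card_Un_disjoint card_image finite_distinct_partitions)
qed

text \<open>The shift is the staircase sum 0 + 1 + ... + (i - 1). With it built in, the recurrence
  for distinct parts becomes the one for \<open>num_partitions_parts\<close>, so induction on
  \<open>r + i\<close> applies.\<close>

lemma card_distinct_partitions:
  "card (distinct_partitions i (r + i * (i - 1) div 2)) = num_partitions_parts r i"
proof (induction "r + i" arbitrary: r i rule: less_induct)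
  case less
  show ?case
  proof (cases i)
    case 0
    have "distinct_partitions 0 r = (if r = 0 then {{}} else {})"
      by (auto simp: distinct_partitions_def)
    with 0 show ?thesis
      by (simp add: num_partitions_parts_0_0 num_partitions_parts_n_0)
  next
    case (Suc j)
    \<comment> \<open>The increment of the staircase from \<open>j\<close> to \<open>Suc j\<close>
      elements; it is what turns \<open>t\<close> into \<open>t + j\<close> in the term with
      \<open>j\<close> parts.\<close>
    have tri: "Suc j * j div 2 = j + j * (j - 1) div 2" by (cases j) auto
    show ?thesis
    proof (cases "r < i")
      case True
      \<comment> \<open>Both sides vanish here: \<open>i\<close> distinct positive numbers already
        sum to at least \<open>i + i * (i - 1) div 2\<close>.\<close>
      have False if "S \<in> distinct_partitions i (r + i * (i - 1) div 2)" for S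
      proof -
        have "S \<subseteq> {0<..}" using that by (auto simp: distinct_partitions_def intro!: gr0I)
        then have "i * (i + 1) div 2 \<le> r + i * (i - 1) div 2"
          using that sum_lower_bound[of S 0] by (auto simp: distinct_partitions_def)
        moreover have "i * (i + 1) div 2 = i + i * (i - 1) div 2"
          using Suc by auto
        ultimately show False using True by simp
      qed
      then have "distinct_partitions i (r + i * (i - 1) div 2) = {}" by blast
      with True show ?thesis by (simp add: num_partitions_parts_eq_0)
    next
      case False
      then obtain t where t: "r = t + Suc j" using Suc by (metis add.commute le_Suc_ex not_less)
      have "card (distinct_partitions i (r + i * (i - 1) div 2)) =
          card (distinct_partitions (Suc j) ((t + Suc j * j div 2) + Suc j))"
        by (simp add: Suc t add_ac)
      also have "\<dots> = card (distinct_partitions (Suc j) (t + Suc j * (Suc j - 1) div 2)) +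
          card (distinct_partitions j ((t + j) + j * (j - 1) div 2))"
        unfolding card_distinct_partitions_rec tri by (simp add: tri add_ac del: mult_Suc)
      also have "\<dots> = num_partitions_parts t (Suc j) + num_partitions_parts (t + j) j"
        using less[of t "Suc j"] less[of "t + j" j] Suc t by simp
      finally show ?thesis
        by (simp add: Suc t num_partitions_parts_recurrence del: add_Suc_right)
    qed
  qed
qed

text \<open>Translation by \<open>m\<close> reduces to distinct positive parts with sum
  \<open>k\<close>. The hypothesis keeps the subtraction of the staircase from \<open>k\<close>
  untruncated.\<close>

lemma card_distinct_partitions_above:
  assumes "i * (i + 1) div 2 \<le> k"
  shows "card {S. finite S \<and> S \<subseteq> {m<..} \<and> card S = i \<and> \<Sum>S = k + m * i} =
    num_partitions_parts (k - i * (i - 1) div 2) i"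
proof -
  have "{S. finite S \<and> S \<subseteq> {m<..} \<and> card S = i \<and> \<Sum>S = k + m * i} =
      (`) ((+) m) ` distinct_partitions i k" (is "?L = ?R")
  proof (intro equalityI subsetI)
    fix S assume S: "S \<in> ?L"
    obtain T where T: "S = (+) m ` T"
    proof
      have "(\<lambda>x. m + (x - m)) ` S = id ` S"
        using S by (intro image_cong) auto
      then show "S = (+) m ` ((\<lambda>x. x - m) ` S)"
        by (simp add: image_image)
    qed
    have "T \<in> distinct_partitions i k"
      using S unfolding T
      by (auto simp: distinct_partitions_def sum_image_add card_image finite_image_iff)
    with T show "S \<in> ?R" by blast
  next
    fix S assume "S \<in> ?R"
    then show "S \<in> ?L"
      by (auto simp: distinct_partitions_def sum_image_add card_image intro!: gr0I)
  qed
  moreover have "inj_on ((`) ((+) m)) X" for X :: "nat set set"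
    by (auto simp: inj_on_def inj_image_eq_iff)
  moreover have "i * (i - 1) div 2 \<le> i * (i + 1) div 2"
    by (intro div_le_mono mult_le_mono) auto
  then have "k = (k - i * (i - 1) div 2) + i * (i - 1) div 2"
    using assms by linarith
  ultimately show ?thesis
    using card_distinct_partitions[of i "k - i * (i - 1) div 2"] by (simp add: card_image)
qed

section \<open>Inclusion-exclusion over forbidden parts\<close>

lemma sum_Pow_signs:
  "finite A \<Longrightarrow> (\<Sum>S\<in>Pow A. (-1) ^ card S) = (if A = {} then 1 else (0::int))"
  \<comment> \<open>Expand the product of the factors \<open>1 - 1\<close> over
    \<open>A\<close>.\<close>
  using prod_diff_conv_sum[of A "\<lambda>_. 1::int" "\<lambda>_. 1"]
  by (cases "A = {}") (simp_all add: power_0_left)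

text \<open>The indicator of having no part above \<open>m\<close> is the alternating sum over all
  subsets of the parts above \<open>m\<close>. Exchanging the sums leaves, for each
  \<open>S\<close>, the partitions whose parts include \<open>S\<close>.\<close>

lemma card_partitions_bounded_signed_sum:
  "int (card {M \<in> partitions n. \<forall>x\<in>#M. x \<le> m}) =
    (\<Sum>S | S \<subseteq> {m<..n} \<and> \<Sum>S \<le> n. (-1) ^ card S * int (num_partitions (n - \<Sum>S)))"
proof -
  have le: "x \<le> n" if "M \<in> partitions n" "x \<in># M" for M x
    using that sum_mset.remove[of x M] by (auto simp: partitions_def)
  have sumle: "\<Sum>S \<le> n" if "M \<in> partitions n" "S \<subseteq> set_mset M" for M S
  proof -
    have "mset_set S \<subseteq># M" using that(2) by (rule mset_set_subseteq)
    then have "sum_mset (mset_set S) \<le> sum_mset M" by (metis le_add1 subset_mset.add_diff_inverse sum_mset.union)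
    with that(1) show ?thesis by (simp add: partitions_def sum_unfold_sum_mset)
  qed
  have "int (card {M \<in> partitions n. \<forall>x\<in>#M. x \<le> m}) =
      (\<Sum>M\<in>partitions n. if \<forall>x\<in>#M. x \<le> m then 1 else 0)"
    by (simp add: finite_partitions flip: sum.inter_filter)
  also have "\<dots> = (\<Sum>M\<in>partitions n. \<Sum>S\<in>Pow {x \<in> set_mset M. m < x}. (-1) ^ card S)"
    by (intro sum.cong) (auto simp: sum_Pow_signs not_less)
  \<comment> \<open>The added bounds hold for every set of parts of a partition of \<open>n\<close>.
    They give a finite range for \<open>S\<close> independent of \<open>M\<close>, as the exchange
    of sums requires.\<close>
  also have "\<dots> = (\<Sum>M\<in>partitions n. \<Sum>S | S \<in> {S. S \<subseteq> {m<..n} \<and> \<Sum>S \<le> n} \<and> S \<subseteq> set_mset M. (-1) ^ card S)"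
  proof (intro sum.cong refl)
    fix M assume M: "M \<in> partitions n"
    show "Pow {x \<in> set_mset M. m < x} =
        {S \<in> {S. S \<subseteq> {m<..n} \<and> \<Sum>S \<le> n}. S \<subseteq> set_mset M}"
    proof (intro equalityI subsetI)
      fix S assume S: "S \<in> Pow {x \<in> set_mset M. m < x}"
      then have "S \<subseteq> set_mset M" by blast
      with sumle[OF M] have "\<Sum>S \<le> n" by blast
      with S le[OF M] show "S \<in> {S \<in> {S. S \<subseteq> {m<..n} \<and> \<Sum>S \<le> n}. S \<subseteq> set_mset M}"
        by auto
    qed auto
  qed
  also have "\<dots> = (\<Sum>S | S \<subseteq> {m<..n} \<and> \<Sum>S \<le> n. \<Sum>M | M \<in> partitions n \<and> S \<subseteq> set_mset M. (-1) ^ card S)"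
    by (rule sum.swap_restrict) (auto simp: finite_partitions)
  also have "\<dots> = (\<Sum>S | S \<subseteq> {m<..n} \<and> \<Sum>S \<le> n. (-1) ^ card S * int (num_partitions (n - \<Sum>S)))"
  proof (intro sum.cong refl)
    fix S assume "S \<in> {S. S \<subseteq> {m<..n} \<and> \<Sum>S \<le> n}"
    then show "(\<Sum>M | M \<in> partitions n \<and> S \<subseteq> set_mset M. (-1) ^ card S) =
        (-1) ^ card S * int (num_partitions (n - \<Sum>S))"
      by (subst card_partitions_superset[symmetric]) (auto intro: finite_subset)
  qed
  finally show ?thesis .
qed

section \<open>The summation bound \<open>i_max\<close>\<close>

lemma le_i_max:
  assumes "i * (i + 1) div 2 + m * (i + 1) \<le> n"
  shows "i \<le> nat (i_max n m)"
proof -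
  have "i * (i + 1) = 2 * (i * (i + 1) div 2)" by simp
  then have "i * (i + 1) + 2 * (m * (i + 1)) \<le> 2 * n" using assms by linarith
  then have "real (i * (i + 1) + 2 * (m * (i + 1))) \<le> real (2 * n)" by (simp only: of_nat_le_iff)
  \<comment> \<open>Completing the square: the difference of the two squares is
    \<open>4 * (i + 1) * (i + 2 * m)\<close>, four times the left side of the previous
    inequality.\<close>
  then have "(2 * real i + 2 * real m + 1)\<^sup>2 \<le> 8 * real n + (2 * real m - 1)\<^sup>2"
    by (simp add: power2_eq_square algebra_simps)
  then have "2 * real i + 2 * real m + 1 \<le> sqrt (8 * real n + (2 * real m - 1)\<^sup>2)"
    by (rule real_le_rsqrt)
  then have "int i \<le> i_max n m"
    unfolding i_max_def le_floor_iff by simp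
  then show ?thesis by simp
qed

lemma le_of_le_i_max:
  assumes "m \<le> n" "i \<le> nat (i_max n m)"
  shows "i * (i + 1) div 2 + m * (i + 1) \<le> n"
\<comment> \<open>For \<open>i = 0\<close> the bound through \<open>nat\<close> carries no
  information about \<open>i_max\<close>, and the claim is just \<open>m \<le> n\<close>.\<close>
proof (cases "i = 0")
  case False
  then have "int i \<le> i_max n m" using assms by linarith
  then have "2 * real i + 2 * real m + 1 \<le> sqrt (8 * real n + (2 * real m - 1)\<^sup>2)"
    unfolding i_max_def le_floor_iff by simp
  then have "(2 * real i + 2 * real m + 1)\<^sup>2 \<le> 8 * real n + (2 * real m - 1)\<^sup>2"
    by (intro sqrt_ge_absD) simp
  then have "real (i * (i + 1) + 2 * (m * (i + 1))) \<le> real (2 * n)"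
    by (simp add: power2_eq_square algebra_simps)
  then have "i * (i + 1) + 2 * (m * (i + 1)) \<le> 2 * n" by (simp only: of_nat_le_iff)
  then show ?thesis by linarith
qed (use assms in simp)

section \<open>Collecting the signed sum by size and sum of the forbidden sets\<close>

theorem mainTheorem1:
  fixes n m :: nat
  assumes "m \<le> n"
  shows "int (num_partitions_parts n m) =
    int (num_partitions (n - m)) +
    (\<Sum>i = 1..nat (i_max n m). (-1) ^ i *
      (\<Sum>k = i * (i + 1) div 2..n - m * (i + 1).
        int (num_partitions_parts (k - i * (i - 1) div 2) i) *
        int (num_partitions (n - k - m * (i + 1)))))"
proof -
  let ?I = "nat (i_max n m)" and ?N = "n - m"
  let ?K = "\<lambda>i. {i * (i + 1) div 2..n - m * (i + 1)}"
  define F where "F i k = int (num_partitions_parts (k - i * (i - 1) div 2) i) *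
    int (num_partitions (n - k - m * (i + 1)))" for i k
  define \<S> where "\<S> = {S. S \<subseteq> {m<..?N} \<and> \<Sum>S \<le> ?N}"
  define h where "h S = (-1) ^ card S * int (num_partitions (?N - \<Sum>S))" for S
  \<comment> \<open>The index pair \<open>(i, k)\<close> of the double sum to which \<open>S\<close>
    contributes. On \<open>\<S>\<close> the difference is not truncated, by \<open>low\<close>
    below.\<close>
  define g where "g S = (card S, \<Sum>S - m * card S)" for S
  have fin: "finite S" if "S \<in> \<S>" for S
    using that finite_subset[of S "{m<..?N}"] by (auto simp: \<S>_def)
  have low: "card S * (card S + 1) div 2 + m * card S \<le> \<Sum>S" if "S \<in> \<S>" for S
    using that by (intro sum_lower_bound fin) (auto simp: \<S>_def)
  \<comment> \<open>The lower limit of \<open>k\<close> is \<open>low\<close>, the upper one is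
    \<open>\<Sum>S \<le> ?N\<close>; together they make the range of \<open>k\<close> nonempty,
    which is what bounds \<open>i\<close> by \<open>?I\<close>. The index \<open>i = 0\<close>
    accounts for the empty set.\<close>
  have g: "g ` \<S> \<subseteq> Sigma {0..?I} ?K"
  proof safe
    fix i k S assume S: "S \<in> \<S>" and "(i, k) = g S"
    then have ik: "i = card S" "k = \<Sum>S - m * card S" by (auto simp: g_def)
    have "\<Sum>S \<le> n - m" using S by (simp add: \<S>_def)
    with low[OF S] assms have *: "i * (i + 1) div 2 \<le> k" "k + m * (i + 1) \<le> n"
      unfolding ik by (auto simp: algebra_simps)
    then show "i \<in> {0..?I}" "k \<in> ?K i" by (auto intro!: le_i_max)
  qed
  have fibre: "(\<Sum>S | S \<in> \<S> \<and> g S = (i, k). h S) = (-1) ^ i * F i k"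
    if i: "i \<in> {0..?I}" and k: "k \<in> ?K i" for i k
  proof -
    \<comment> \<open>Since \<open>i\<close> is at most \<open>?I\<close>, the upper limit
      \<open>n - m * (i + 1)\<close> is a genuine difference.\<close>
    have kn: "k + m * i \<le> ?N"
    proof -
      have "i * (i + 1) div 2 + m * (i + 1) \<le> n"
        using i by (intro le_of_le_i_max assms) simp
      then have "m * i + m \<le> n" by simp
      moreover have "k \<le> n - (m * i + m)" using k by (simp add: add.commute)
      ultimately show ?thesis by linarith
    qed
    \<comment> \<open>By \<open>kn\<close> a set with this sum automatically obeys the upper bounds
      in \<open>\<S>\<close>, each element being at most the sum. So the fibre is a set already
      counted.\<close>
    have "{S. S \<in> \<S> \<and> g S = (i, k)} =
        {S. finite S \<and> S \<subseteq> {m<..} \<and> card S = i \<and> \<Sum>S = k + m * i}" (is "?L = ?R")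
    proof (intro equalityI subsetI)
      fix S assume S: "S \<in> ?L"
      then show "S \<in> ?R" using fin[of S] low[of S] by (auto simp: \<S>_def g_def)
    next
      fix S assume S: "S \<in> ?R"
      then have "x \<le> ?N" if "x \<in> S" for x
        using member_le_sum[OF that, of "\<lambda>x. x"] kn by auto
      with S kn show "S \<in> ?L" by (auto simp: \<S>_def g_def)
    qed
    moreover have "h S = (-1) ^ i * int (num_partitions (n - k - m * (i + 1)))" if "S \<in> ?R" for S
      using that by (simp add: h_def algebra_simps)
    ultimately have "(\<Sum>S | S \<in> \<S> \<and> g S = (i, k). h S) =
        int (card ?R) * ((-1) ^ i * int (num_partitions (n - k - m * (i + 1))))"
      by simp
    then show ?thesis
      using k by (simp add: card_distinct_partitions_above F_def)
  qed
  have "int (num_partitions_parts n m) = (\<Sum>S\<in>\<S>. h S)"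
    using card_partitions_bounded_signed_sum[of ?N m] assms
    unfolding card_partitions_bounded h_def \<S>_def by simp
  also have "\<dots> = (\<Sum>p\<in>Sigma {0..?I} ?K. \<Sum>S | S \<in> \<S> \<and> g S = p. h S)"
    by (rule sum.group[symmetric]) (use g in \<open>auto simp: \<S>_def\<close>)
  also have "\<dots> = (\<Sum>(i, k)\<in>Sigma {0..?I} ?K. (-1) ^ i * F i k)"
    by (intro sum.cong) (auto simp: fibre)
  also have "\<dots> = (\<Sum>i = 0..?I. (-1) ^ i * (\<Sum>k\<in>?K i. F i k))"
    by (simp add: sum.Sigma sum_distrib_left)
  also have "\<dots> = (\<Sum>k = 0..?N. F 0 k) + (\<Sum>i = 1..?I. (-1) ^ i * (\<Sum>k\<in>?K i. F i k))"
    by (simp add: sum.atLeast_Suc_atMost)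
  \<comment> \<open>With no parts only \<open>k = 0\<close> survives, since
    \<open>P(k, 0) = 0\<close> for positive \<open>k\<close>; this yields the leading term.\<close>
  also have "(\<Sum>k = 0..?N. F 0 k) = (\<Sum>k\<in>{0}. F 0 k)"
    by (rule sum.mono_neutral_right) (auto simp: F_def num_partitions_parts_n_0)
  also have "\<dots> = int (num_partitions (n - m))"
    by (simp add: F_def num_partitions_parts_0_0)
  finally show ?thesis by (simp only: F_def)
qed

end
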